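(* A function $f:\mathbb{R}\to\mathbb{R}$ is horizontally rigid via translations if and only if there exists $r\in\mathbb{R}$ such that $f$ is constant on $(-\infty,r)$ and $f$ is constant on $(r,\infty)$ (the two constants may differ, and $f(r)$ is arbitrary).
   Context: A function $f:\mathbb{R}\to\mathbb{R}$ is horizontally rigid via translations if for every $c\in(0,\infty)$ there exists a translation of the plane $\mathbb{R}^2$ mapping the graph of the function $x\mapsto f(cx)$ onto the graph of $f$, where the graph of $h:\mathbb{R}\to\mathbb{R}$ is $\{(x,h(x)):x\in\mathbb{R}\}$. *)

theory Defs
  imports "HOL-Analysis.Analysis"
begin

definition fun_graph :: "(real \<Rightarrow> real) \<Rightarrow> (real \<times> real) set" where
  "fun_graph h = {(x, h x) | x. x \<in> UNIV}"

(* A translation of the plane is a map (+) v with v in R^2; it acts on sets of points by image. *)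
definition horizontally_rigid_via_translations :: "(real \<Rightarrow> real) \<Rightarrow> bool" where
  "horizontally_rigid_via_translations f \<longleftrightarrow>
     (\<forall>c>0. \<exists>v :: real \<times> real. (+) v ` fun_graph (\<lambda>x. f (c * x)) = fun_graph f)"

end

theory Submission
  imports Defs
begin

text \<open>
  Rigidity says that for every \<open>c > 0\<close> some affine map \<open>x \<mapsto> c x + d\<close> changes \<open>f\<close> only by an additive
  constant. If \<open>c \<noteq> 1\<close>, this map has a fixed point, and evaluating there shows that the constant
  vanishes. If all these maps share one fixed point \<open>r\<close>, then \<open>f\<close> is invariant under all dilations
  about \<open>r\<close>, hence constant on either side of \<open>r\<close>. Otherwise the commutator of two of them with
  different fixed points is a nonzero translation, so \<open>f\<close> has a period; conjugating with the affine
  maps multiplies the period by every \<open>c > 0\<close>, so \<open>f\<close> is constant.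
\<close>

lemma translate_fun_graph_eq_iff:
  "(+) (a, b) ` fun_graph g = fun_graph h \<longleftrightarrow> (\<forall>x. h x = g (x - a) + b)"
proof -
  have "(+) (a, b) ` fun_graph g = fun_graph (\<lambda>x. g (x - a) + b)"
  proof (intro set_eqI iffI)
    fix p assume "p \<in> fun_graph (\<lambda>x. g (x - a) + b)"
    then obtain x where "p = (a, b) + (x - a, g (x - a))"
      by (auto simp: fun_graph_def)
    moreover have "(x - a, g (x - a)) \<in> fun_graph g"
      by (auto simp: fun_graph_def)
    ultimately show "p \<in> (+) (a, b) ` fun_graph g"
      by (rule image_eqI)
  qed (auto simp: fun_graph_def)
  moreover have "fun_graph k = fun_graph h \<longleftrightarrow> (\<forall>x. h x = k x)" for k
    by (auto simp: fun_graph_def set_eq_iff)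
  ultimately show ?thesis by simp
qed

lemma horizontally_rigid_iff_affine:
  "horizontally_rigid_via_translations f \<longleftrightarrow> (\<forall>c>0. \<exists>a b. \<forall>x. f x = f (c * (x - a)) + b)"
  unfolding horizontally_rigid_via_translations_def split_paired_Ex translate_fun_graph_eq_iff ..

lemma horizontally_rigid_dilation:
  assumes "horizontally_rigid_via_translations f" and "c > 0" and "c \<noteq> 1"
  obtains s where "\<And>x. f (c * (x - s) + s) = f x"
proof -
  obtain a b where ab: "\<And>x. f x = f (c * (x - a)) + b"
    using assms horizontally_rigid_iff_affine by metis
  \<comment> \<open>The fixed point of the map \<open>x\<close> to
    \<open>c * (x - a)\<close>.\<close>
  define s where "s = c * a / (c - 1)"
  have "s * (c - 1) = c * a"
    using \<open>c \<noteq> 1\<close> by (simp add: s_def)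
  then have s: "c * (x - a) = c * (x - s) + s" for x
    by (simp add: algebra_simps)
  have "b = 0"
    using ab[of s] s[of s] by simp
  then have "f (c * (x - s) + s) = f x" for x
    using ab[of x] s[of x] by simp
  then show ?thesis
    by (rule that)
qed

theorem theorem6p2:
  fixes f :: "real \<Rightarrow> real"
  shows "horizontally_rigid_via_translations f \<longleftrightarrow>
    (\<exists>r. f constant_on {..<r} \<and> f constant_on {r<..})"
proof
  assume rigid: "horizontally_rigid_via_translations f"
  \<comment> \<open>Any positive factor other than 1 would serve; its centre is the candidate break
    point.\<close>
  obtain r where r: "\<And>x. f (2 * (x - r) + r) = f x"
    using horizontally_rigid_dilation[OF rigid, of 2] by auto
  show "\<exists>r. f constant_on {..<r} \<and> f constant_on {r<..}"
  proof (cases "\<forall>c>0. \<forall>x. f (c * (x - r) + r) = f x")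
    case True
    \<comment> \<open>The dilation about \<open>r\<close> with factor \<open>r - x\<close> sends
      \<open>r - 1\<close> to \<open>x\<close>.\<close>
    have "f x = f (r - 1)" if "x < r" for x
      using True[rule_format, of "r - x" "r - 1"] that by simp
    moreover have "f x = f (r + 1)" if "x > r" for x
      using True[rule_format, of "x - r" "r + 1"] that by simp
    ultimately show ?thesis
      unfolding constant_on_def by blast
  next
    case False
    then obtain c x0 where c: "c > 0" and x0: "f (c * (x0 - r) + r) \<noteq> f x0"
      by blast
    then have "c \<noteq> 1" by auto
    then obtain s where s: "\<And>x. f (c * (x - s) + s) = f x"
      using horizontally_rigid_dilation[OF rigid c] by blast
    have "s \<noteq> r" using s x0 by auto
    \<comment> \<open>With D the dilation by 2 about \<open>r\<close> and C the one by
      \<open>c\<close> about \<open>s\<close>, \<open>t\<close> is the constant difference D(C(x)) -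
      C(D(x)).\<close>
    define t where "t = (1 - c) * (s - r)"
    have "t \<noteq> 0" using \<open>c \<noteq> 1\<close> \<open>s \<noteq> r\<close> by (simp add: t_def)
    have period: "f (y + t) = f y" for y
    proof -
      \<comment> \<open>Solves C(D(x)) = \<open>y\<close>, so that D(C(x)) =
        \<open>y + t\<close>.\<close>
      define x where "x = ((y - s) / c + s - r) / 2 + r"
      have y: "y = c * (2 * (x - r) + r - s) + s"
        using c by (simp add: x_def field_simps)
      have "y + t = 2 * (c * (x - s) + s - r) + r"
        unfolding y t_def by (simp add: algebra_simps)
      then show ?thesis
        using y r s by metis
    qed
    have scaled: "f (y + k * t) = f y" if k: "k > 0" for k y
    proof (cases "k = 1")
      case False
      then obtain q where q: "\<And>x. f (k * (x - q) + q) = f x"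
        using horizontally_rigid_dilation[OF rigid k] by blast
      \<comment> \<open>The dilation by \<open>k\<close> about \<open>q\<close> sends
        \<open>x\<close> to \<open>y\<close> and \<open>x + t\<close> to
        \<open>y + k * t\<close>.\<close>
      define x where "x = (y - q) / k + q"
      have y: "y = k * (x - q) + q"
        using k by (simp add: x_def field_simps)
      then have "y + k * t = k * (x + t - q) + q"
        by (simp add: algebra_simps)
      then show ?thesis
        using y q period by metis
    qed (simp add: period)
    have "f y = f 0" for y
    proof -
      \<comment> \<open>Only positive multiples of \<open>t\<close> are known periods, so one steps
        from 0 to \<open>y\<close> or from \<open>y\<close> to 0.\<close>
      consider "y = 0" | "y / t > 0" | "- y / t > 0"
        using \<open>t \<noteq> 0\<close> by (cases "y / t" "0 :: real" rule: linorder_cases) auto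
      then show ?thesis
        using scaled[of "y / t" 0] scaled[of "- y / t" y] \<open>t \<noteq> 0\<close> by cases auto
    qed
    then show ?thesis
      unfolding constant_on_def by blast
  qed
next
  assume "\<exists>r. f constant_on {..<r} \<and> f constant_on {r<..}"
  then obtain r p q where p: "\<And>x. x < r \<Longrightarrow> f x = p" and q: "\<And>x. x > r \<Longrightarrow> f x = q"
    unfolding constant_on_def by (metis lessThan_iff greaterThan_iff)
  \<comment> \<open>The shift \<open>r - r / c\<close> makes \<open>r\<close> a fixed point, so each
    side of \<open>r\<close> is preserved.\<close>
  have "f x = f (c * (x - (r - r / c))) + 0" if c: "c > 0" for c x
  proof -
    have eq: "c * (x - (r - r / c)) = r + c * (x - r)"
      using c by (simp add: field_simps)
    consider "x < r" | "x = r" | "x > r" by linarith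
    then show ?thesis
    proof cases
      case 2
      then show ?thesis unfolding eq by simp
    next
      case 1
      then have "r + c * (x - r) < r" using c by (simp add: mult_pos_neg)
      then show ?thesis using 1 p unfolding eq by simp
    next
      case 3
      then have "r + c * (x - r) > r" using c by simp
      then show ?thesis using 3 q unfolding eq by simp
    qed
  qed
  then show "horizontally_rigid_via_translations f"
    unfolding horizontally_rigid_iff_affine by blast
qed

end
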